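(* For every nonnegative integer $N$, $$\mathbf{P}_{E(\varnothing,[1,\infty))}=\sum_{n=0}^{N}(-1)^n\Big(\mathbf{P}_{E([n+1,2n],\varnothing)}-\mathbf{P}_{E([n+1,2n+1],\varnothing)}\Big)-(-1)^N\sum_{k\ge1}\mathbf{P}_{E([k+1+N,\,k+1+2N],\,[1+N,\,k+N])}.$$
   Context: Fix a real number $q$ with $0<q<1$. Let $\mathbb{N}=\{0,1,2,\dots\}$ and $\mathbb{N}_+=\{1,2,3,\dots\}$. For $a,b\in\mathbb{N}$, $[a,b]=\{n\in\mathbb{N}:a\le n\le b\}$ (empty if $a>b$) and $[a,\infty)=\{n\in\mathbb{N}:n\ge a\}$. Shuffling model: a random process producing at each time $k\ge 0$ a sequence $\mathfrak{s}_k$ which is an arrangement of the numbers $0,1,\dots,k$. At time $0$, $\mathfrak{s}_0=(0)$. At time $k\ge 1$, given $\mathfrak{s}_{k-1}=(s_0,\dots,s_{k-1})$, one appends $k$ to obtain $(s_0,\dots,s_{k-1},k)$ and then moves $k$ to the left by $i_k$ positions, where $i_k\in\{0,1,\dots,k\}$ is random with $\Pr(i_k=0)=1-q$, $\Pr(i_k=i)=q^i(1-q)$ for $1\le i\le k-1$, and $\Pr(i_k=k)=q^k$; the random variables $i_k$ ($k\ge1$) are mutually independent. The outcomes are the infinite runs of this process (equivalently the sequences $(i_k)_{k\ge 1}$ with $i_k\in\{0,\dots,k\}$), with the induced probability measure $\mathbf{P}$; for an event $E$, $\mathbf{P}_E$ denotes its probability. The step at time $k$ is called leftmost if $i_k=k$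 (i.e. $k$ is the first entry of $\mathfrak{s}_k$) and anti-leftmost if $i_k<k$. For disjoint subsets $I,J\subseteq\mathbb{N}_+$, $E(I,J)$ denotes the event that the step at time $k$ is leftmost for every $k\in I$ and anti-leftmost for every $k\in J$ (no condition at times outside $I\cup J$). *)

theory Defs
  imports "HOL-Probability.Probability"
begin

text \<open>
  An outcome is recorded by its sequence of displacements \<open>\<omega> k = i\<^sub>k\<close>, indexed by \<open>k \<ge> 1\<close>
  (as an extensional function, i.e. \<open>undefined\<close> at \<open>0\<close>).
\<close>

definition runs :: "(nat \<Rightarrow> nat) set" where
  "runs = (\<Pi>\<^sub>E k\<in>{1..}. {0..k})"

primrec arrangement :: "(nat \<Rightarrow> nat) \<Rightarrow> nat \<Rightarrow> nat list" where
  "arrangement \<omega> 0 = [0]"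
| "arrangement \<omega> (Suc m) =
     (let s = arrangement \<omega> m; k = Suc m in take (k - \<omega> k) s @ k # drop (k - \<omega> k) s)"

text \<open>
  For \<open>k \<ge> 1\<close> the case \<open>i = 0\<close> of the law of \<open>i\<^sub>k\<close> is covered by \<open>q ^ 0 * (1 - q) = 1 - q\<close>.
\<close>

definition displacement_prob :: "real \<Rightarrow> nat \<Rightarrow> nat \<Rightarrow> real" where
  "displacement_prob q k i = (if i = k then q ^ k else q ^ i * (1 - q))"

definition displacement_law :: "real \<Rightarrow> nat \<Rightarrow> nat measure" where
  "displacement_law q k = point_measure {0..k} (\<lambda>i. ennreal (displacement_prob q k i))"

definition shuffle_measure :: "real \<Rightarrow> (nat \<Rightarrow> nat) measure" where
  "shuffle_measure q = (\<Pi>\<^sub>M k\<in>{1..}. displacement_law q k)"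

definition leftmost :: "(nat \<Rightarrow> nat) \<Rightarrow> nat \<Rightarrow> bool" where
  "leftmost \<omega> k \<longleftrightarrow> \<omega> k = k"

definition anti_leftmost :: "(nat \<Rightarrow> nat) \<Rightarrow> nat \<Rightarrow> bool" where
  "anti_leftmost \<omega> k \<longleftrightarrow> \<omega> k < k"

definition event_E :: "nat set \<Rightarrow> nat set \<Rightarrow> (nat \<Rightarrow> nat) set" where
  "event_E I J = {\<omega> \<in> runs. (\<forall>k\<in>I. leftmost \<omega> k) \<and> (\<forall>k\<in>J. anti_leftmost \<omega> k)}"

abbreviation shuffle_prob :: "real \<Rightarrow> (nat \<Rightarrow> nat) set \<Rightarrow> real" where
  "shuffle_prob q A \<equiv> measure (shuffle_measure q) A"

lemma length_arrangement: "length (arrangement \<omega> k) = Suc k"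
  by (induction k) (auto simp: Let_def)

lemma set_arrangement: "set (arrangement \<omega> k) = {0..k}"
proof (induction k)
  case (Suc m)
  define n where "n = Suc m - \<omega> (Suc m)"
  have "set (arrangement \<omega> (Suc m)) =
      insert (Suc m) (set (take n (arrangement \<omega> m) @ drop n (arrangement \<omega> m)))"
    unfolding set_append by (simp add: Let_def n_def)
  then show ?case
    using Suc unfolding append_take_drop_id by auto
qed simp

lemma leftmost_iff_hd_arrangement:
  assumes "\<omega> \<in> runs" "k \<ge> 1"
  shows "leftmost \<omega> k \<longleftrightarrow> hd (arrangement \<omega> k) = k"
proof -
  obtain m where k: "k = Suc m"
    using assms(2) by (cases k) auto
  have le: "\<omega> k \<le> k"
    using assms by (auto simp: runs_def PiE_iff)
  have ne: "arrangement \<omega> m \<noteq> []"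
    using length_arrangement[of \<omega> m] by auto
  have "hd (arrangement \<omega> m) \<noteq> k"
    using hd_in_set[OF ne] by (auto simp: set_arrangement k)
  then show ?thesis
    using le ne unfolding leftmost_def k by (auto simp: Let_def hd_append)
qed

lemma sum_displacement_prob: "(\<Sum>i\<in>{0..k}. displacement_prob q k i) = 1"
proof -
  have "(\<Sum>i\<in>{0..k}. displacement_prob q k i) = q ^ k + (\<Sum>i<k. q ^ i * (1 - q))"
  proof -
    have *: "{0..k} = insert k {..<k}"
      by auto
    show ?thesis
      unfolding * by (simp add: displacement_prob_def)
  qed
  also have "(\<Sum>i<k. q ^ i * (1 - q)) = 1 - q ^ k"
    by (induction k) (auto simp: algebra_simps)
  finally show ?thesis
    by simp
qed

lemma space_shuffle_measure: "space (shuffle_measure q) = runs"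
  by (simp add: shuffle_measure_def runs_def displacement_law_def space_PiM space_point_measure)

lemma prob_space_displacement_law:
  assumes "0 < q" "q < 1"
  shows "prob_space (displacement_law q k)"
proof
  have nn: "0 \<le> displacement_prob q k i" for i
    using assms by (simp add: displacement_prob_def)
  show "emeasure (displacement_law q k) (space (displacement_law q k)) = 1"
    by (simp add: displacement_law_def space_point_measure emeasure_point_measure_finite
        sum_ennreal nn sum_displacement_prob)
qed

lemma prob_space_shuffle_measure:
  assumes "0 < q" "q < 1"
  shows "prob_space (shuffle_measure q)"
  unfolding shuffle_measure_def by (intro prob_space_PiM prob_space_displacement_law assms)

lemma event_E_measurable:
  assumes "I \<subseteq> {1..}" "J \<subseteq> {1..}"
  shows "event_E I J \<in> sets (shuffle_measure q)"
proof -
  have pred: "Measurable.pred (shuffle_measure q) (\<lambda>\<omega>. Q (\<omega> k))" if "k \<in> {1..}" for k Q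
  proof -
    have "(\<lambda>\<omega>. \<omega> k) \<in> measurable (shuffle_measure q) (displacement_law q k)"
      unfolding shuffle_measure_def using that by (rule measurable_component_singleton)
    moreover have "Measurable.pred (displacement_law q k) Q"
      by (auto simp: displacement_law_def pred_def space_point_measure sets_point_measure)
    ultimately show ?thesis
      by (rule measurable_compose)
  qed
  have "Measurable.pred (shuffle_measure q)
          (\<lambda>\<omega>. (\<forall>k\<in>I. leftmost \<omega> k) \<and> (\<forall>k\<in>J. anti_leftmost \<omega> k))"
    unfolding leftmost_def anti_leftmost_def
    using assms by (intro pred_intros_logic pred_intros_countable_bounded pred) auto
  then show ?thesis
    by (simp add: pred_def event_E_def space_shuffle_measure)
qed

end

theory Submission
  imports Defs
begin

text \<open>
  Steps are independent and the step at time \<open>k\<close> is leftmost with probability \<open>q ^ k\<close>.  Write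
  \<open>T\<^sub>N(k)\<close> for the probability of \<open>E([k+1+N, k+1+2N], [1+N, k+N])\<close>.  For \<open>N = 0\<close> the terms
  \<open>T\<^sub>0(k)\<close> are the successive differences of the probabilities of \<open>E(\<emptyset>, [1, k])\<close>, which decrease
  to that of \<open>E(\<emptyset>, [1, \<infinity>))\<close>.  The induction on \<open>N\<close> rests on the telescoping relation
  \<open>T\<^sub>N(k+1) + T\<^sub>N\<^sub>+\<^sub>1(k) = F(k) - F(k+1)\<close>, where \<open>F(k)\<close> is the probability of
  \<open>E([k+N+2, k+2N+2], [N+2, k+N+1])\<close>: condition first on the step at time \<open>N+1\<close>, replace the
  weight of a block of \<open>N+1\<close> leftmost steps together with \<open>N+1\<close> by that of the block shifted
  by one, and then condition on the step at time \<open>k+N+2\<close>.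
\<close>

text \<open>By independence this is the probability of \<open>E(I, J)\<close> for disjoint finite
  sets of positive times. The algebra below is done on this product, free of measure theory.\<close>

definition step_weight :: "real \<Rightarrow> nat set \<Rightarrow> nat set \<Rightarrow> real" where
  "step_weight q I J = (\<Prod>i\<in>I. q ^ i) * (\<Prod>j\<in>J. 1 - q ^ j)"

lemma measure_displacement_law:
  assumes "0 < q" "q < 1"
  shows "measure (displacement_law q k) {k} = q ^ k"
    and "measure (displacement_law q k) {..<k} = 1 - q ^ k"
proof -
  interpret prob_space "displacement_law q k"
    using assms by (rule prob_space_displacement_law)
  show *: "measure (displacement_law q k) {k} = q ^ k"
    using assms
    by (simp add: measure_def displacement_law_def emeasure_point_measure_finite
        displacement_prob_def)
  have "{..<k} = space (displacement_law q k) - {k}"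
    by (auto simp: displacement_law_def space_point_measure)
  then show "measure (displacement_law q k) {..<k} = 1 - q ^ k"
    using prob_compl[of "{k}"] *
    by (simp add: displacement_law_def sets_point_measure)
qed

text \<open>The event is a cylinder over the coordinates in \<open>I \<union> J\<close>, so its
  product measure factors into the marginal probabilities.\<close>

lemma shuffle_prob_event_E:
  assumes "0 < q" "q < 1" "finite I" "finite J" "I \<subseteq> {1..}" "J \<subseteq> {1..}" "I \<inter> J = {}"
  shows "shuffle_prob q (event_E I J) = step_weight q I J"
proof -
  interpret product_prob_space "displacement_law q" "{1..}"
    by (intro product_prob_spaceI prob_space_displacement_law assms)
  define X where "X k = (if k \<in> I then {k} else {..<k})" for k :: nat
  have "event_E I J = prod_emb {1..} (displacement_law q) (I \<union> J) (\<Pi>\<^sub>E k\<in>I \<union> J. X k)"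
  proof -
    have space: "space (displacement_law q k) = {0..k}" for k
      by (simp add: displacement_law_def space_point_measure)
    have "prod_emb {1..} (displacement_law q) (I \<union> J) (\<Pi>\<^sub>E k\<in>I \<union> J. X k) =
        (\<Pi>\<^sub>E k\<in>{1..}. if k \<in> I \<union> J then X k else {0..k})"
      unfolding space[symmetric] using assms(5,6)
      by (intro prod_emb_PiE) (auto simp: X_def space)
    also have "\<dots> = event_E I J"
    proof (intro set_eqI iffI)
      fix \<omega> assume \<omega>: "\<omega> \<in> (\<Pi>\<^sub>E k\<in>{1..}. if k \<in> I \<union> J then X k else {0..k})"
      then have mem: "\<omega> k \<in> (if k \<in> I \<union> J then X k else {0..k})" if "k \<in> {1..}" for k
        using that by (rule PiE_mem)
      have "\<omega> k = k" if "k \<in> I" for k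
        using mem[of k] that assms(5) by (auto simp: X_def)
      moreover have "\<omega> k < k" if "k \<in> J" for k
      proof -
        have "k \<in> {1..}" "k \<notin> I"
          using that assms(6,7) by auto
        then show ?thesis
          using mem[of k] that by (simp add: X_def)
      qed
      moreover have "\<omega> k \<in> {0..k}" if "k \<in> {1..}" for k
        using mem[OF that] by (auto simp: X_def split: if_splits)
      ultimately show "\<omega> \<in> event_E I J"
        using \<omega> unfolding event_E_def runs_def leftmost_def anti_leftmost_def PiE_iff by blast
    next
      fix \<omega> assume "\<omega> \<in> event_E I J"
      then show "\<omega> \<in> (\<Pi>\<^sub>E k\<in>{1..}. if k \<in> I \<union> J then X k else {0..k})"
        by (simp add: event_E_def runs_def leftmost_def anti_leftmost_def PiE_iff X_def)
    qed
    finally show ?thesis ..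
  qed
  then have "shuffle_prob q (event_E I J) = (\<Prod>k\<in>I \<union> J. measure (displacement_law q k) (X k))"
    unfolding shuffle_measure_def using assms(3-6)
    by (simp only:, intro measure_PiM_emb)
      (auto simp: X_def displacement_law_def sets_point_measure)
  also have "\<dots> = (\<Prod>k\<in>I. measure (displacement_law q k) (X k)) *
      (\<Prod>k\<in>J. measure (displacement_law q k) (X k))"
    using assms by (intro prod.union_disjoint) auto
  also have "\<dots> = step_weight q I J"
    unfolding step_weight_def using assms
    by (intro arg_cong2[where f = "(*)"] prod.cong) (auto simp: X_def measure_displacement_law)
  finally show ?thesis .
qed

lemma step_weight_nonneg:
  assumes "0 < q" "q < 1"
  shows "0 \<le> step_weight q I J"
  unfolding step_weight_def using assms
  by (intro mult_nonneg_nonneg prod_nonneg) (auto simp: power_le_one)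

lemma step_weight_le_power:
  assumes "0 < q" "q < 1" "finite I" "i \<in> I"
  shows "step_weight q I J \<le> q ^ i"
proof -
  have "step_weight q I J \<le> (\<Prod>i\<in>I. q ^ i) * 1"
    unfolding step_weight_def using assms(1,2)
    by (intro mult_left_mono prod_le_1 prod_nonneg) (auto simp: power_le_one)
  also have "(\<Prod>i\<in>I. q ^ i) = q ^ i * (\<Prod>j\<in>I - {i}. q ^ j)"
    using assms(3,4) by (rule prod.remove)
  also have "\<dots> \<le> q ^ i * 1"
    using assms(1,2) by (intro mult_left_mono prod_le_1) (auto simp: power_le_one)
  finally show ?thesis
    by simp
qed

text \<open>Conditioning on the step at time \<open>k\<close>: the two alternatives carry the
  factors \<open>q ^ k\<close> and \<open>1 - q ^ k\<close>, which add up to 1.\<close>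

lemma step_weight_split:
  assumes "finite I" "finite J" "k \<notin> I" "k \<notin> J"
  shows "step_weight q I J = step_weight q (insert k I) J + step_weight q I (insert k J)"
  using assms by (simp add: step_weight_def algebra_simps)

text \<open>Raising the exponent of each of the \<open>N + 1\<close> factors by one costs exactly
  \<open>q ^ (N + 1)\<close>.\<close>

lemma prod_power_shift:
  fixes q :: real
  shows "q ^ Suc N * (\<Prod>i = m..m + N. q ^ i) = (\<Prod>i = Suc m..Suc (m + N). q ^ i)"
proof -
  have "(\<Prod>i = Suc m..Suc (m + N). q ^ i) = (\<Prod>i = m..m + N. q * q ^ i)"
    unfolding prod.shift_bounds_cl_Suc_ivl by simp
  then show ?thesis
    by (simp add: prod.distrib del: prod.cl_ivl_Suc)
qed

text \<open>The value at \<open>k = 0\<close> is outside the sum of the theorem, but the induction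
  on \<open>N\<close> needs it: there the anti-leftmost block is empty.\<close>

definition remainder_term :: "real \<Rightarrow> nat \<Rightarrow> nat \<Rightarrow> real" where
  "remainder_term q N k = step_weight q {k+1+N..k+1+2*N} {1+N..k+N}"

lemma remainder_term_telescope:
  fixes q :: real
  defines "F \<equiv> \<lambda>N k. step_weight q {k+N+2..k+2*N+2} {N+2..k+N+1}"
  shows "remainder_term q N (Suc k) + remainder_term q (Suc N) k = F N k - F N (Suc k)"
proof -
  define I where "I = {k+N+2..k+2*N+2}"
  define I' where "I' = {k+N+3..k+2*N+3}"
  define J where "J = {N+2..k+N+1}"
  have fin: "finite I" "finite I'" "finite J"
    by (simp_all add: I_def I'_def J_def)
  have "step_weight q I J =
      step_weight q (insert (Suc N) I) J + step_weight q I (insert (Suc N) J)"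
    using fin by (intro step_weight_split) (auto simp: I_def J_def)
  \<comment> \<open>The block \<open>I\<close> has length \<open>N + 1\<close>, so a leftmost step
    at time \<open>N + 1\<close> pays for shifting it to \<open>I'\<close>.\<close>
  moreover have "step_weight q (insert (Suc N) I) J = step_weight q I' J"
  proof -
    have "q ^ Suc N * (\<Prod>i\<in>I. q ^ i) = (\<Prod>i\<in>I'. q ^ i)"
      using prod_power_shift[of q N "k+N+2"]
      by (simp add: I_def I'_def mult_2 add_ac numeral_eq_Suc)
    moreover have "Suc N \<notin> I"
      by (simp add: I_def)
    ultimately show ?thesis
      using fin by (simp add: step_weight_def)
  qed
  moreover have "step_weight q I' J =
      step_weight q (insert (k+N+2) I') J + step_weight q I' (insert (k+N+2) J)"
    using fin by (intro step_weight_split) (auto simp: I'_def J_def)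
  moreover have "insert (Suc N) J = {1+N..Suc k+N}" "insert (k+N+2) I' = {k+1+Suc N..k+1+2*Suc N}"
    "insert (k+N+2) J = {N+2..Suc k+N+1}"
    by (auto simp: I'_def J_def)
  moreover have "I = {Suc k+1+N..Suc k+1+2*N}" "I' = {Suc k+N+2..Suc k+2*N+2}"
    "J = {1+Suc N..k+Suc N}"
    by (auto simp: I_def I'_def J_def)
  ultimately show ?thesis
    by (simp add: remainder_term_def F_def flip: I_def J_def)
qed

text \<open>The claimed identity solved for the remainder, with \<open>p\<close> an abstract limit;
  \<open>Suc k\<close> makes the summation start at 1.\<close>

lemma remainder_terms_sums:
  assumes "0 < q" "q < 1"
    and lim: "(\<lambda>n. step_weight q {} {1..n}) \<longlonglongrightarrow> p"
  shows "(\<lambda>k. remainder_term q N (Suc k)) sums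
    ((-1)^N * ((\<Sum>n=0..N. (-1)^n * (step_weight q {n+1..2*n} {} - step_weight q {n+1..2*n+1} {})) - p))"
proof (induction N)
  case 0
  have "remainder_term q 0 (Suc k) =
      step_weight q {} {1..Suc k} - step_weight q {} {1..Suc (Suc k)}" for k
    by (simp add: remainder_term_def step_weight_def algebra_simps)
  moreover have "(\<lambda>k. step_weight q {} {1..Suc k}) \<longlonglongrightarrow> p"
    using lim by (rule LIMSEQ_Suc)
  ultimately have "(\<lambda>k. remainder_term q 0 (Suc k)) sums (step_weight q {} {1..Suc 0} - p)"
    using telescope_sums'[of "\<lambda>k. step_weight q {} {1..Suc k}" p] by simp
  \<comment> \<open>The weight of \<open>{1..Suc 0}\<close> is \<open>1 - q\<close>, which is the
    summand \<open>n = 0\<close>.\<close>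
  then show ?case
    by (simp add: step_weight_def)
next
  case (Suc N)
  define S where "S = (\<Sum>n=0..N. (-1)^n *
    (step_weight q {n+1..2*n} {} - step_weight q {n+1..2*n+1} {}))"
  define F where "F k = step_weight q {k+N+2..k+2*N+2} {N+2..k+N+1}" for k
  \<comment> \<open>The leftmost block of \<open>F k\<close> always contains the time
    \<open>k+N+2\<close>, whose factor alone tends to 0.\<close>
  have "F \<longlonglongrightarrow> 0"
  proof (rule tendsto_sandwich)
    show "\<forall>\<^sub>F k in sequentially. 0 \<le> F k"
      using assms by (simp add: F_def step_weight_nonneg)
    show "\<forall>\<^sub>F k in sequentially. F k \<le> q ^ (k + (N+2))"
      using assms step_weight_le_power[of q "{k+N+2..k+2*N+2}" "k+N+2" for k]
      by (simp add: F_def)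
    show "(\<lambda>k. q ^ (k + (N+2))) \<longlonglongrightarrow> 0"
      using assms by (intro LIMSEQ_ignore_initial_segment LIMSEQ_power_zero) simp
  qed simp
  then have "(\<lambda>k. F k - F (Suc k)) sums (F 0 - 0)"
    by (rule telescope_sums')
  then have "(\<lambda>k. F k - F (Suc k) - remainder_term q N (Suc k)) sums (F 0 - (-1)^N * (S - p))"
    using sums_diff Suc.IH unfolding S_def by fastforce
  moreover have "remainder_term q (Suc N) = (\<lambda>k. F k - F (Suc k) - remainder_term q N (Suc k))"
  proof
    show "remainder_term q (Suc N) k = F k - F (Suc k) - remainder_term q N (Suc k)" for k
      using remainder_term_telescope[of q N k] by (simp add: F_def)
  qed
  ultimately have "remainder_term q (Suc N) sums (F 0 - (-1)^N * (S - p))"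
    by simp
  \<comment> \<open>The telescoped series starts at \<open>k = 0\<close>. Dropping that term leaves,
    next to \<open>F 0\<close>, exactly the difference in the summand
    \<open>n = N + 1\<close>.\<close>
  then have "(\<lambda>k. remainder_term q (Suc N) (Suc k)) sums
      (F 0 - (-1)^N * (S - p) - remainder_term q (Suc N) 0)"
    by (subst sums_Suc_iff) simp
  moreover have "F 0 = step_weight q {Suc N+1..2*Suc N} {}"
    "remainder_term q (Suc N) 0 = step_weight q {Suc N+1..2*Suc N+1} {}"
    by (simp_all add: F_def remainder_term_def)
  moreover have "(-1)^Suc N * ((-1)^Suc N * x) = x" for x :: real
    by (simp flip: power_add mult.assoc)
  ultimately show ?case
    by (simp add: S_def algebra_simps)
qed

theorem theorem5p1:
  fixes q :: real and N :: nat
  assumes "0 < q" and "q < 1"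
  shows "(\<lambda>k. shuffle_prob q (event_E {k+1+N..k+1+2*N} {1+N..k+N})) summable_on {1..} \<and>
    shuffle_prob q (event_E {} {1..}) =
      (\<Sum>n=0..N. (-1)^n * (shuffle_prob q (event_E {n+1..2*n} {}) - shuffle_prob q (event_E {n+1..2*n+1} {})))
      - (-1)^N * (\<Sum>\<^sub>\<infinity>k\<in>{1..}. shuffle_prob q (event_E {k+1+N..k+1+2*N} {1+N..k+N}))"
proof -
  interpret prob_space "shuffle_measure q"
    using assms by (rule prob_space_shuffle_measure)
  define p where "p = shuffle_prob q (event_E {} {1..})"
  define S where "S = (\<Sum>n=0..N. (-1)^n *
    (step_weight q {n+1..2*n} {} - step_weight q {n+1..2*n+1} {}))"
  have S: "S = (\<Sum>n=0..N. (-1)^n *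
      (shuffle_prob q (event_E {n+1..2*n} {}) - shuffle_prob q (event_E {n+1..2*n+1} {})))"
    unfolding S_def using assms by (subst (1 2) shuffle_prob_event_E) auto
  have prob_eq: "shuffle_prob q (event_E {k+1+N..k+1+2*N} {1+N..k+N}) = remainder_term q N k" for k
    unfolding remainder_term_def using assms by (intro shuffle_prob_event_E) auto
  \<comment> \<open>The product formula covers finite sets only; continuity from above reaches
    \<open>{1..}\<close>.\<close>
  have "(\<lambda>n. shuffle_prob q (event_E {} {1..n})) \<longlonglongrightarrow> shuffle_prob q (\<Inter>n. event_E {} {1..n})"
  proof (rule finite_Lim_measure_decseq)
    show "range (\<lambda>n. event_E {} {1..n}) \<subseteq> events"
      by (intro image_subsetI event_E_measurable) auto
    show "decseq (\<lambda>n. event_E {} {1..n})"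
      by (auto simp: decseq_def event_E_def)
  qed
  moreover have "(\<Inter>n. event_E {} {1..n}) = event_E {} {1..}"
    by (fastforce simp: event_E_def)
  moreover have "shuffle_prob q (event_E {} {1..n}) = step_weight q {} {1..n}" for n
    using assms by (intro shuffle_prob_event_E) auto
  ultimately have "(\<lambda>n. step_weight q {} {1..n}) \<longlonglongrightarrow> p"
    by (simp add: p_def)
  then have "(\<lambda>k. remainder_term q N (Suc k)) sums ((-1)^N * (S - p))"
    unfolding S_def using assms by (intro remainder_terms_sums)
  \<comment> \<open>Nonnegative terms turn the ordered series into an unconditional sum.\<close>
  then have "((\<lambda>k. remainder_term q N (Suc k)) has_sum ((-1)^N * (S - p))) UNIV"
    using assms
    by (intro sums_nonneg_imp_has_sum) (auto simp: remainder_term_def step_weight_nonneg)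
  moreover have "bij_betw Suc UNIV {1..}"
    by (rule bij_betwI[where g = "\<lambda>k. k - 1"]) auto
  ultimately have "(remainder_term q N has_sum ((-1)^N * (S - p))) {1..}"
    using has_sum_reindex_bij_betw by blast
  then have "remainder_term q N summable_on {1..}"
    and "infsum (remainder_term q N) {1..} = (-1)^N * (S - p)"
    by (auto simp: has_sum_imp_summable infsumI)
  moreover have "(-1)^N * ((-1)^N * x) = x" for x :: real
    by (simp flip: power_add mult.assoc)
  ultimately show ?thesis
    unfolding prob_eq S[symmetric] p_def[symmetric] by simp
qed

end
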